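(* Let $\ell\in\{4,5\}$ and let $G=(V,E)$ be a finite connected simple graph with $E\ne\varnothing$ and $\operatorname{girth}(G)\ge\ell$. Then the bound $$\kappa_{\max}^{\mathrm{LLY}}(G)\le 4-\ell+\frac{\ell-2}{\operatorname{mad}(G)}$$ is attained by a positive weight (i.e. there is $w:E\to(0,\infty)$ with $\kappa_{\mathrm{LLY}}^w(G)=4-\ell+\frac{\ell-2}{\operatorname{mad}(G)}$) if and only if $G$ is $d$-regular for some $d$ and $\mathcal M_\ell(e)$ has a perfect matching for every $e\in E$. In that case $$\kappa_{\max}^{\mathrm{LLY}}(G)=4-\ell+\frac{\ell-2}{d},$$ and every maximizing weight is constant up to global scaling (i.e. assigns the same value to all edges).
   Context: Graphs are finite, simple and undirected. $\operatorname{girth}(G)$ is the length of a shortest cycle of $G$, with $\operatorname{girth}(G)=\infty$ if $G$ is a tree. The maximum average degree is $\operatorname{mad}(G):=\max_{\varnothing\ne H\subseteq G}\frac{2|E(H)|}{|V(H)|}$, the maximum being over nonempty subgraphs $H$ of $G$. $N(x)$ is the set of neighbors of $x$. For an edge $e=xy$ put $X_e:=N(x)\setminus\{y\}$ and $Y_e:=N(y)\setminus\{x\}$ (disjoint when $e$ lies in no triangle). The auxiliary bipartite graph $\mathcal M_\ell(e)$ has parts $X_e$ and $Y_e$, with $u\in X_e$ and $v\in Y_e$ adjacent if and only if $\operatorname{dist}_G(u,v)=\ell-3$. (If both parts are empty, the empty matching is a perfect matching.) Lin--Lu--Yau curvature with fixed combinatorial distance: let $G=(V,E)$ be finite and connected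 with $E\neq\varnothing$, and let $\operatorname{dist}_G$ be its combinatorial (shortest-path) distance. A positive edge weight is a function $w:E\to(0,\infty)$; put $d_x^w:=\sum_{z\sim x}w_{xz}$. For $\alpha\in[0,1]$ and $x\in V$ let $\mu_x^{\alpha,w}$ be the probability measure on $V$ with $\mu_x^{\alpha,w}(x)=\alpha$, $\mu_x^{\alpha,w}(z)=(1-\alpha)w_{xz}/d_x^w$ if $z\sim x$, and $\mu_x^{\alpha,w}(z)=0$ otherwise. Let $W_1$ be the $1$-Wasserstein distance with respect to $\operatorname{dist}_G$ (independent of $w$). For an edge $e=xy$, put $\kappa_\alpha^w(x,y):=1-W_1(\mu_x^{\alpha,w},\mu_y^{\alpha,w})$ and $$\kappa_{\mathrm{LLY}}^w(e)=\kappa_{\mathrm{LLY}}^w(x,y):=\lim_{\alpha\to1^-}\frac{\kappa_\alpha^w(x,y)}{1-\alpha}.$$ Put $\kappa_{\mathrm{LLY}}^w(G):=\min_{e\in E}\kappa_{\mathrm{LLY}}^w(e)$ and $\kappa_{\max}^{\mathrm{LLY}}(G):=\sup_{w:E\to(0,\infty)}\kappa_{\mathrm{LLY}}^w(G)$. A maximizing weight is a positive edge weight $w$ with $\kappa_{\mathrm{LLY}}^w(G)=\kappa_{\max}^{\mathrm{LLY}}(G)$. *)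

theory Defs
  imports Complex_Main "HOL-Library.Extended_Nat"
begin

text \<open>A graph is given by its vertex set \<open>V\<close> and its set \<open>E\<close> of two-element edges.\<close>

definition finite_simple_graph :: "'a set \<Rightarrow> 'a set set \<Rightarrow> bool" where
  "finite_simple_graph V E \<longleftrightarrow> finite V \<and> (\<forall>e\<in>E. e \<subseteq> V \<and> card e = 2)"

definition nbrs :: "'a set set \<Rightarrow> 'a \<Rightarrow> 'a set" where
  "nbrs E x = {z. {x, z} \<in> E}"

definition adj_rel :: "'a set set \<Rightarrow> ('a \<times> 'a) set" where
  "adj_rel E = {(x, y). {x, y} \<in> E}"

definition connected_graph :: "'a set \<Rightarrow> 'a set set \<Rightarrow> bool" where
  "connected_graph V E \<longleftrightarrow> V \<noteq> {} \<and> (\<forall>u\<in>V. \<forall>v\<in>V. (u, v) \<in> (adj_rel E)\<^sup>*)"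

definition regular_graph :: "'a set \<Rightarrow> 'a set set \<Rightarrow> nat \<Rightarrow> bool" where
  "regular_graph V E d \<longleftrightarrow> (\<forall>x\<in>V. card (nbrs E x) = d)"

text \<open>Membership in the \<open>n\<close>-th relational power means that there is a walk with \<open>n\<close> edges.
  The value is meaningful only for vertices in the same component.\<close>

definition gdist :: "'a set set \<Rightarrow> 'a \<Rightarrow> 'a \<Rightarrow> nat" where
  "gdist E u v = (LEAST n. (u, v) \<in> adj_rel E ^^ n)"

definition is_cycle :: "'a set set \<Rightarrow> 'a list \<Rightarrow> bool" where
  "is_cycle E c \<longleftrightarrow> 3 \<le> length c \<and> distinct c \<and>
     (\<forall>i<length c. {c ! i, c ! (Suc i mod length c)} \<in> E)"

text \<open>The infimum of the empty set in \<^typ>\<open>enat\<close> is \<open>\<infinity>\<close>, so acyclic graphs have infinite girth.\<close>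

definition girth :: "'a set set \<Rightarrow> enat" where
  "girth E = (INF c\<in>{c. is_cycle E c}. enat (length c))"

definition mad :: "'a set \<Rightarrow> 'a set set \<Rightarrow> real" where
  "mad V E = Max {2 * real (card E') / real (card V') | V' E'.
     V' \<noteq> {} \<and> V' \<subseteq> V \<and> E' \<subseteq> E \<and> (\<forall>e\<in>E'. e \<subseteq> V')}"

definition perfect_matching :: "'a set \<Rightarrow> 'a set set \<Rightarrow> 'a set set \<Rightarrow> bool" where
  "perfect_matching V E M \<longleftrightarrow> M \<subseteq> E \<and> (\<forall>v\<in>V. \<exists>!e. e \<in> M \<and> v \<in> e)"

text \<open>The bipartite graph attached to the edge \<open>xy\<close>. It does not depend on the order of \<open>x\<close>
  and \<open>y\<close>, and its two parts are disjoint when \<open>xy\<close> lies in no triangle.\<close>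

definition aux_part :: "'a set set \<Rightarrow> 'a \<Rightarrow> 'a \<Rightarrow> 'a set" where
  "aux_part E x y = nbrs E x - {y}"

definition aux_verts :: "'a set set \<Rightarrow> 'a \<Rightarrow> 'a \<Rightarrow> 'a set" where
  "aux_verts E x y = aux_part E x y \<union> aux_part E y x"

definition aux_edges :: "nat \<Rightarrow> 'a set set \<Rightarrow> 'a \<Rightarrow> 'a \<Rightarrow> 'a set set" where
  "aux_edges l E x y =
     {{u, v} | u v. u \<in> aux_part E x y \<and> v \<in> aux_part E y x \<and> gdist E u v = l - 3}"

text \<open>Weights are functions on all sets of vertices; only their values on \<open>E\<close> are ever used.\<close>

definition pos_weight :: "'a set set \<Rightarrow> ('a set \<Rightarrow> real) \<Rightarrow> bool" where
  "pos_weight E w \<longleftrightarrow> (\<forall>e\<in>E. 0 < w e)"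

definition wdeg :: "'a set set \<Rightarrow> ('a set \<Rightarrow> real) \<Rightarrow> 'a \<Rightarrow> real" where
  "wdeg E w x = (\<Sum>z\<in>nbrs E x. w {x, z})"

text \<open>Probability measures on the finite set \<open>V\<close> are represented by their mass functions.\<close>

definition lazy_measure :: "'a set set \<Rightarrow> ('a set \<Rightarrow> real) \<Rightarrow> real \<Rightarrow> 'a \<Rightarrow> 'a \<Rightarrow> real" where
  "lazy_measure E w \<alpha> x z =
     (if z = x then \<alpha>
      else if z \<in> nbrs E x then (1 - \<alpha>) * w {x, z} / wdeg E w x
      else 0)"

definition coupling :: "'a set \<Rightarrow> ('a \<Rightarrow> real) \<Rightarrow> ('a \<Rightarrow> real) \<Rightarrow> ('a \<Rightarrow> 'a \<Rightarrow> real) \<Rightarrow> bool" where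
  "coupling V \<mu> \<nu> \<pi> \<longleftrightarrow>
     (\<forall>u\<in>V. \<forall>v\<in>V. 0 \<le> \<pi> u v) \<and>
     (\<forall>u\<in>V. (\<Sum>v\<in>V. \<pi> u v) = \<mu> u) \<and>
     (\<forall>v\<in>V. (\<Sum>u\<in>V. \<pi> u v) = \<nu> v)"

definition W1 :: "'a set \<Rightarrow> 'a set set \<Rightarrow> ('a \<Rightarrow> real) \<Rightarrow> ('a \<Rightarrow> real) \<Rightarrow> real" where
  "W1 V E \<mu> \<nu> =
     (INF \<pi>\<in>{\<pi>. coupling V \<mu> \<nu> \<pi>}. \<Sum>u\<in>V. \<Sum>v\<in>V. \<pi> u v * real (gdist E u v))"

definition kappa_alpha ::
    "'a set \<Rightarrow> 'a set set \<Rightarrow> ('a set \<Rightarrow> real) \<Rightarrow> real \<Rightarrow> 'a \<Rightarrow> 'a \<Rightarrow> real" where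
  "kappa_alpha V E w \<alpha> x y = 1 - W1 V E (lazy_measure E w \<alpha> x) (lazy_measure E w \<alpha> y)"

definition kappa_LLY ::
    "'a set \<Rightarrow> 'a set set \<Rightarrow> ('a set \<Rightarrow> real) \<Rightarrow> 'a \<Rightarrow> 'a \<Rightarrow> real" where
  "kappa_LLY V E w x y = Lim (at_left 1) (\<lambda>\<alpha>. kappa_alpha V E w \<alpha> x y / (1 - \<alpha>))"

text \<open>Each edge \<open>xy\<close> occurs below with both orders of its endpoints; the curvature is symmetric.\<close>

definition kappa_LLY_graph :: "'a set \<Rightarrow> 'a set set \<Rightarrow> ('a set \<Rightarrow> real) \<Rightarrow> real" where
  "kappa_LLY_graph V E w = Min {kappa_LLY V E w x y | x y. {x, y} \<in> E}"

definition kappa_LLY_max :: "'a set \<Rightarrow> 'a set set \<Rightarrow> real" where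
  "kappa_LLY_max V E = (SUP w\<in>{w. pos_weight E w}. kappa_LLY_graph V E w)"

definition maximizing_weight :: "'a set \<Rightarrow> 'a set set \<Rightarrow> ('a set \<Rightarrow> real) \<Rightarrow> bool" where
  "maximizing_weight V E w \<longleftrightarrow> pos_weight E w \<and> kappa_LLY_graph V E w = kappa_LLY_max V E"

end

theory Submission
  imports Defs
begin

text \<open>
  Let \<open>p = step_prob E w x y\<close> and \<open>q = step_prob E w y x\<close> be the probabilities that the weighted
  random walk crosses the edge \<open>xy\<close> in either direction. Large girth keeps the remaining
  neighbours \<open>X\<close> of \<open>x\<close> and \<open>Y\<close> of \<open>y\<close> at distance at least \<open>l - 3\<close> from each other. Hence the
  potential with values \<open>-1, 0, 1, l - 4\<close> on \<open>X, x, y, Y\<close> grows by at most the distance on pairs that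
  a transport plan can use, and Kantorovich duality gives (\<open>kappa_LLY_le_step_prob\<close>)
  \<open>\<kappa>(x,y) \<le> 2 p - (l - 4) (1 - q)\<close>. The mean of this bound and of the one with \<open>x\<close> and \<open>y\<close> exchanged is
  \<open>4 - l + (l - 2)/2 \<cdot> (p + q)\<close>. Call \<open>p + q\<close> the flow of the edge. The walk leaves each vertex with total
  probability 1, so the flows of the edges of a subgraph \<open>(V', E')\<close> add up to at most \<open>|V'|\<close>, and some
  edge of it has flow at most \<open>|V'| / |E'|\<close>. For a densest subgraph this number is \<open>2 / mad\<close>,
  which proves the upper bound (\<open>kappa_LLY_graph_le_mad\<close>).

  If a weight attains the bound, all these inequalities are equalities (\<open>extremal_weight\<close>). In a densest
  subgraph no walk step may leave the subgraph, so by connectedness it is the whole graph. Each of the two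
  unsymmetric bounds is then attained at every edge, which forces \<open>p = q = 1 / mad\<close>. Thus \<open>x\<close> and \<open>y\<close>
  have the same weighted degree for every edge \<open>xy\<close>, so the weighted degree, and with it the weight, is
  constant, and the graph is regular of degree \<open>d = mad\<close>. Refining the potential by a set \<open>S\<close> of
  vertices of \<open>X\<close> and the set \<open>N\<close> of their partners in \<open>Y\<close> at distance exactly \<open>l - 3\<close> improves the
  bound by \<open>(|S| - |N|) / d\<close>. Equality therefore implies \<open>|S| \<le> |N|\<close>, and Hall's theorem yields the perfect
  matching (\<open>matching_of_kappa_LLY\<close>).

  Conversely, in a \<open>d\<close>-regular graph with unit weights and laziness \<open>1 / (d + 1)\<close> the two measures are
  uniform on the closed neighbourhoods of \<open>x\<close> and \<open>y\<close>. Moving \<open>X\<close> to \<open>Y\<close> along the matching and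
  leaving \<open>x\<close> and \<open>y\<close> in place gives a plan whose cost is small enough to reach the bound
  (\<open>kappa_LLY_ge_of_matching\<close>). Since \<open>\<kappa>\<^sub>\<alpha> / (1 - \<alpha>)\<close> increases with \<open>\<alpha>\<close>
  (\<open>kappa_alpha_ratio_mono\<close>), this single \<open>\<alpha>\<close> bounds the limit from below. The same monotonicity
  is the reason why the limit defining the curvature exists.
\<close>

section \<open>Hall's marriage theorem\<close>

text \<open>Rado's argument: if a set \<open>N x\<close> contains two distinct points, one of them can be deleted
  without destroying Hall's condition. Otherwise there are violating families \<open>S\<close> and \<open>T\<close>, one for
  each deletion. Together their neighbourhoods contain all of \<open>N x\<close>, so Hall's condition for
  \<open>S \<union> T \<union> {x}\<close> and for \<open>S \<inter> T\<close> contradicts the submodularity of cardinality.\<close>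

lemma hall_shrink:
  fixes N :: "'a \<Rightarrow> 'b set"
  assumes X: "finite X" and fin: "\<And>x. x \<in> X \<Longrightarrow> finite (N x)"
    and hall: "\<And>S. S \<subseteq> X \<Longrightarrow> card S \<le> card (\<Union>(N ` S))"
    and x: "x \<in> X" and ab: "a \<noteq> b"
  shows "\<exists>c\<in>{a, b}. \<forall>S\<subseteq>X. card S \<le> card (\<Union>((N(x := N x - {c})) ` S))"
proof (rule ccontr)
  assume neg: "\<not> ?thesis"
  have violated: "\<exists>S\<subseteq>X - {x}. card (\<Union>(N ` S) \<union> (N x - {c})) \<le> card S" if "c \<in> {a, b}" for c
  proof -
    have "\<not> (\<forall>S\<subseteq>X. card S \<le> card (\<Union>((N(x := N x - {c})) ` S)))"
      using neg that by (elim contrapos_nn) (rule bexI)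
    then obtain T where T: "T \<subseteq> X" "card (\<Union>((N(x := N x - {c})) ` T)) < card T"
      by (auto simp only: not_all not_imp not_le)
    have xT: "x \<in> T"
    proof (rule ccontr)
      assume "x \<notin> T"
      then have "(N(x := N x - {c})) ` T = N ` T" by (intro image_cong) auto
      then show False using T hall[of T] by simp
    qed
    have "\<Union>((N(x := N x - {c})) ` T) = \<Union>(N ` (T - {x})) \<union> (N x - {c})"
      using xT by auto
    moreover have "card T = Suc (card (T - {x}))"
      using xT T(1) X by (metis card.remove finite_subset)
    ultimately have "card (\<Union>(N ` (T - {x})) \<union> (N x - {c})) \<le> card (T - {x})"
      using T(2) by (simp only: less_Suc_eq_le)
    moreover have "T - {x} \<subseteq> X - {x}" using T(1) by blast
    ultimately show ?thesis by blast
  qed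
  from violated[of a] violated[of b] obtain S T where
    S: "S \<subseteq> X - {x}" "card (\<Union>(N ` S) \<union> (N x - {a})) \<le> card S" and
    T: "T \<subseteq> X - {x}" "card (\<Union>(N ` T) \<union> (N x - {b})) \<le> card T" by auto
  let ?A = "\<Union>(N ` S) \<union> (N x - {a})" and ?B = "\<Union>(N ` T) \<union> (N x - {b})"
  have finST: "finite S" "finite T" using S T X by (meson finite_Diff finite_subset)+
  have finAB: "finite ?A" "finite ?B" using S T fin x finST by auto
  have "Suc (card (S \<union> T)) = card (insert x (S \<union> T))"
    using S T finST by (subst card_insert_disjoint) auto
  also have "\<dots> \<le> card (\<Union>(N ` insert x (S \<union> T)))"
    using S T x by (intro hall) auto
  also have "\<Union>(N ` insert x (S \<union> T)) = ?A \<union> ?B" using ab by auto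
  finally have 1: "Suc (card (S \<union> T)) \<le> card (?A \<union> ?B)" .
  have "card (S \<inter> T) \<le> card (\<Union>(N ` (S \<inter> T)))" using S by (intro hall) auto
  also have "\<dots> \<le> card (?A \<inter> ?B)" using finAB by (intro card_mono) auto
  finally have 2: "card (S \<inter> T) \<le> card (?A \<inter> ?B)" .
  show False
    using 1 2 S T card_Un_Int[OF finAB] card_Un_Int[OF finST] by linarith
qed

text \<open>Shrinking the sets as long as possible leaves singletons, and for singletons Hall's
  condition says that the choice is injective.\<close>

lemma hall_marriage:
  fixes N :: "'a \<Rightarrow> 'b set"
  assumes "finite X" and "\<And>x. x \<in> X \<Longrightarrow> finite (N x)"
    and "\<And>S. S \<subseteq> X \<Longrightarrow> card S \<le> card (\<Union>(N ` S))"
  shows "\<exists>m. inj_on m X \<and> (\<forall>x\<in>X. m x \<in> N x)"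
  using assms(2,3)
proof (induction "\<Sum>x\<in>X. card (N x)" arbitrary: N rule: less_induct)
  case less
  show ?case
  proof (cases "\<exists>x\<in>X. \<exists>a\<in>N x. \<exists>b\<in>N x. a \<noteq> b")
    case True
    then obtain x a b where xab: "x \<in> X" "a \<in> N x" "b \<in> N x" "a \<noteq> b" by blast
    obtain c where c: "c \<in> {a, b}"
      and h: "\<And>S. S \<subseteq> X \<Longrightarrow> card S \<le> card (\<Union>((N(x := N x - {c})) ` S))"
      using hall_shrink[OF assms(1) less(2,3) xab(1,4)] by blast
    let ?N = "N(x := N x - {c})"
    have "(\<Sum>y\<in>X. card (?N y)) < (\<Sum>y\<in>X. card (N y))"
    proof (rule sum_strict_mono_ex1[OF assms(1)])
      show "\<forall>y\<in>X. card (?N y) \<le> card (N y)" using less(2) by (auto intro: card_mono)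
      show "\<exists>y\<in>X. card (?N y) < card (N y)"
        using xab c less(2)[of x] by (intro bexI[of _ x]) (auto intro!: psubset_card_mono)
    qed
    then have "\<exists>m. inj_on m X \<and> (\<forall>y\<in>X. m y \<in> ?N y)"
      by (rule less(1)[OF _ _ h]) (use less(2) in auto)
    moreover have "?N y \<subseteq> N y" for y by auto
    ultimately show ?thesis by blast
  next
    case False
    have ne: "N x \<noteq> {}" if "x \<in> X" for x using less(3)[of "{x}"] that by auto
    define m where "m x = (SOME a. a \<in> N x)" for x
    have m: "m x \<in> N x" if "x \<in> X" for x using ne[OF that] by (simp add: m_def some_in_eq)
    have single: "N x = {m x}" if "x \<in> X" for x using False m[OF that] that by blast
    have "inj_on m X"
    proof (rule inj_onI, rule ccontr)
      fix x y assume xy: "x \<in> X" "y \<in> X" "m x = m y" "x \<noteq> y"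
      then have "card {x, y} \<le> card (\<Union>(N ` {x, y}))" by (intro less(3)) auto
      then show False using xy single by auto
    qed
    then show ?thesis using m by blast
  qed
qed

text \<open>A perfect matching is a set of unordered pairs. Disjointness of the two parts orients each
  pair, so that the matching becomes the graph of a bijection.\<close>

lemma perfect_matching_bipartite_iff:
  assumes disj: "X \<inter> Y = {}"
  shows "(\<exists>M. perfect_matching (X \<union> Y) {{u, v} | u v. u \<in> X \<and> v \<in> Y \<and> R u v} M) \<longleftrightarrow>
    (\<exists>m. bij_betw m X Y \<and> (\<forall>u\<in>X. R u (m u)))"
proof
  assume "\<exists>M. perfect_matching (X \<union> Y) {{u, v} | u v. u \<in> X \<and> v \<in> Y \<and> R u v} M"
  then obtain M where
    pm: "perfect_matching (X \<union> Y) {{u, v} | u v. u \<in> X \<and> v \<in> Y \<and> R u v} M" ..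
  have sub: "M \<subseteq> {{u, v} | u v. u \<in> X \<and> v \<in> Y \<and> R u v}"
    using pm by (simp only: perfect_matching_def)
  have uniq: "\<exists>!e. e \<in> M \<and> v \<in> e" if "v \<in> X \<union> Y" for v
    using pm that by (simp only: perfect_matching_def)
  have edge: "\<exists>u\<in>X. \<exists>v\<in>Y. e = {u, v} \<and> R u v" if "e \<in> M" for e
  proof -
    have "\<exists>u v. e = {u, v} \<and> u \<in> X \<and> v \<in> Y \<and> R u v"
      using subsetD[OF sub that] by (simp only: mem_Collect_eq)
    then show ?thesis by (elim exE conjE) (intro bexI conjI)
  qed
  have split: "u \<in> X \<and> v \<in> Y \<and> R u v" if uv: "{u, v} \<in> M" "u \<in> X \<or> v \<in> Y" for u v
  proof -
    obtain u' v' where *: "u' \<in> X" "v' \<in> Y" "{u, v} = {u', v'}" "R u' v'"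
      using edge[OF uv(1)] by (elim bexE conjE)
    then have "u = u' \<and> v = v' \<or> u = v' \<and> v = u'" by (simp add: doubleton_eq_iff)
    then show ?thesis using * uv(2) disj by auto
  qed
  have "\<exists>v. {u, v} \<in> M" if u: "u \<in> X" for u
  proof -
    obtain e where "e \<in> M" "u \<in> e" using uniq[of u] u by auto
    then show ?thesis using edge[of e] by (auto simp: insert_commute)
  qed
  then obtain m where m: "\<And>u. u \<in> X \<Longrightarrow> {u, m u} \<in> M" by metis
  have "inj_on m X"
  proof (rule inj_onI)
    fix u u' assume *: "u \<in> X" "u' \<in> X" "m u = m u'"
    have "m u \<in> Y" using split[OF m] * by auto
    then have "{u, m u} = {u', m u}"
      using uniq[of "m u"] m[OF *(1)] m[OF *(2)] *(3) by (metis UnI2 insertI1 insert_commute)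
    then show "u = u'" by (auto simp: doubleton_eq_iff)
  qed
  moreover have "v \<in> m ` X" if v: "v \<in> Y" for v
  proof -
    obtain e where e: "e \<in> M" "v \<in> e" using uniq[of v] v by auto
    obtain u v' where u: "u \<in> X" "v' \<in> Y" "e = {u, v'}"
      using edge[OF e(1)] by (elim bexE conjE)
    with e(2) v disj have "v' = v" by auto
    have "{u, m u} = e" using uniq[of u] m[OF u(1)] e(1) u by blast
    then show ?thesis using u \<open>v' = v\<close> by (auto simp: doubleton_eq_iff)
  qed
  ultimately show "\<exists>m. bij_betw m X Y \<and> (\<forall>u\<in>X. R u (m u))"
    using split[OF m] by (intro exI[of _ m]) (auto simp: bij_betw_def)
next
  assume "\<exists>m. bij_betw m X Y \<and> (\<forall>u\<in>X. R u (m u))"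
  then obtain m where m: "bij_betw m X Y" and R: "\<And>u. u \<in> X \<Longrightarrow> R u (m u)" by blast
  have mY: "m u \<in> Y" if "u \<in> X" for u using m that by (auto simp: bij_betw_def)
  have inj: "u = u'" if "u \<in> X" "u' \<in> X" "m u = m u'" for u u'
    using m that by (auto simp: bij_betw_def inj_on_def)
  let ?M = "(\<lambda>u. {u, m u}) ` X"
  have "\<exists>!e. e \<in> ?M \<and> v \<in> e" if v: "v \<in> X \<union> Y" for v
  proof (cases "v \<in> X")
    case True
    then show ?thesis using mY disj by (intro ex1I[of _ "{v, m v}"]) auto
  next
    case False
    then obtain u where "u \<in> X" "v = m u" using v m by (auto simp: bij_betw_def)
    then show ?thesis using False inj by (intro ex1I[of _ "{u, m u}"]) auto
  qed
  moreover have "?M \<subseteq> {{u, v} | u v. u \<in> X \<and> v \<in> Y \<and> R u v}" using mY R by blast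
  ultimately have "perfect_matching (X \<union> Y) {{u, v} | u v. u \<in> X \<and> v \<in> Y \<and> R u v} ?M"
    unfolding perfect_matching_def by (intro conjI ballI)
  then show "\<exists>M. perfect_matching (X \<union> Y) {{u, v} | u v. u \<in> X \<and> v \<in> Y \<and> R u v} M" ..
qed

section \<open>Optimal transport and the limit defining the curvature\<close>

lemma W1_le_cost:
  assumes "coupling V \<mu> \<nu> \<pi>"
  shows "W1 V E \<mu> \<nu> \<le> (\<Sum>u\<in>V. \<Sum>v\<in>V. \<pi> u v * real (gdist E u v))"
  unfolding W1_def
proof (rule cINF_lower)
  show "bdd_below ((\<lambda>\<pi>. \<Sum>u\<in>V. \<Sum>v\<in>V. \<pi> u v * real (gdist E u v)) ` {\<pi>. coupling V \<mu> \<nu> \<pi>})"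
    by (rule bdd_belowI2[of _ 0]) (auto simp: coupling_def intro!: sum_nonneg)
qed (use assms in simp)

definition prob_mass :: "'a set \<Rightarrow> ('a \<Rightarrow> real) \<Rightarrow> bool" where
  "prob_mass V \<mu> \<longleftrightarrow> (\<forall>u\<in>V. 0 \<le> \<mu> u) \<and> sum \<mu> V = 1"

text \<open>The product measure is a coupling, so the infimum is not taken over the empty set.\<close>

lemma W1_greatest:
  assumes "prob_mass V \<mu>" "prob_mass V \<nu>"
    and "\<And>\<pi>. coupling V \<mu> \<nu> \<pi> \<Longrightarrow> c \<le> (\<Sum>u\<in>V. \<Sum>v\<in>V. \<pi> u v * real (gdist E u v))"
  shows "c \<le> W1 V E \<mu> \<nu>"
  unfolding W1_def
proof (rule cINF_greatest)
  have "coupling V \<mu> \<nu> (\<lambda>u v. \<mu> u * \<nu> v)"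
    using assms(1,2)
    by (auto simp: coupling_def prob_mass_def sum_distrib_left[symmetric] sum_distrib_right[symmetric])
  then show "{\<pi>. coupling V \<mu> \<nu> \<pi>} \<noteq> {}" by blast
qed (use assms(3) in simp)

text \<open>The easy half of Kantorovich duality. The Lipschitz inequality is required in one direction
  and on the supports only: a coupling charges no other pair. This allows different constraints on
  the two sides of an edge.\<close>

lemma W1_ge_potential:
  assumes fin: "finite V" and pm: "prob_mass V \<mu>" "prob_mass V \<nu>"
    and lip: "\<And>u v. u \<in> V \<Longrightarrow> v \<in> V \<Longrightarrow> \<mu> u \<noteq> 0 \<Longrightarrow> \<nu> v \<noteq> 0 \<Longrightarrow> f v - f u \<le> real (gdist E u v)"
  shows "(\<Sum>v\<in>V. \<nu> v * f v) - (\<Sum>u\<in>V. \<mu> u * f u) \<le> W1 V E \<mu> \<nu>"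
proof (rule W1_greatest[OF pm])
  fix \<pi> assume \<pi>: "coupling V \<mu> \<nu> \<pi>"
  have rows: "(\<Sum>u\<in>V. \<Sum>v\<in>V. \<pi> u v * f u) = (\<Sum>u\<in>V. \<mu> u * f u)"
    using \<pi> by (intro sum.cong) (auto simp: coupling_def sum_distrib_right[symmetric])
  have "(\<Sum>u\<in>V. \<Sum>v\<in>V. \<pi> u v * f v) = (\<Sum>v\<in>V. \<Sum>u\<in>V. \<pi> u v * f v)" by (rule sum.swap)
  also have "\<dots> = (\<Sum>v\<in>V. \<nu> v * f v)"
    using \<pi> by (intro sum.cong) (auto simp: coupling_def sum_distrib_right[symmetric])
  finally have cols: "(\<Sum>u\<in>V. \<Sum>v\<in>V. \<pi> u v * f v) = (\<Sum>v\<in>V. \<nu> v * f v)" .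
  have "\<pi> u v * (f v - f u) \<le> \<pi> u v * real (gdist E u v)" if uv: "u \<in> V" "v \<in> V" for u v
  proof (cases "\<mu> u = 0 \<or> \<nu> v = 0")
    case True
    then have "\<pi> u v = 0"
    proof
      assume "\<mu> u = 0"
      then have "(\<Sum>v\<in>V. \<pi> u v) = 0" using \<pi> uv by (simp add: coupling_def)
      then show ?thesis using \<pi> uv fin by (subst (asm) sum_nonneg_eq_0_iff) (auto simp: coupling_def)
    next
      assume "\<nu> v = 0"
      then have "(\<Sum>u\<in>V. \<pi> u v) = 0" using \<pi> uv by (simp add: coupling_def)
      then show ?thesis using \<pi> uv fin by (subst (asm) sum_nonneg_eq_0_iff) (auto simp: coupling_def)
    qed
    then show ?thesis by simp
  next
    case False
    then show ?thesis using lip uv \<pi> by (intro mult_left_mono) (auto simp: coupling_def)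
  qed
  then have "(\<Sum>u\<in>V. \<Sum>v\<in>V. \<pi> u v * (f v - f u)) \<le> (\<Sum>u\<in>V. \<Sum>v\<in>V. \<pi> u v * real (gdist E u v))"
    by (intro sum_mono)
  then show "(\<Sum>v\<in>V. \<nu> v * f v) - (\<Sum>u\<in>V. \<mu> u * f u)
      \<le> (\<Sum>u\<in>V. \<Sum>v\<in>V. \<pi> u v * real (gdist E u v))"
    by (simp add: right_diff_distrib sum_subtractf rows cols)
qed

text \<open>A bijection between the supports of two measures of the same constant density is a transport
  plan.\<close>

lemma W1_uniform_le_bij:
  assumes fin: "finite V" and T: "bij_betw T A B" and AB: "A \<subseteq> V" "B \<subseteq> V" and c: "0 \<le> c"
  shows "W1 V E (\<lambda>u. if u \<in> A then c else 0) (\<lambda>v. if v \<in> B then c else 0)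
    \<le> c * (\<Sum>u\<in>A. real (gdist E u (T u)))"
proof -
  let ?\<pi> = "\<lambda>u v. if u \<in> A \<and> v = T u then c else 0"
  have TB: "T u \<in> B" if "u \<in> A" for u using T that by (auto simp: bij_betw_def)
  have row: "(\<Sum>v\<in>V. ?\<pi> u v * g v) = (if u \<in> A then c * g (T u) else 0)" for u g
  proof -
    have "(\<Sum>v\<in>V. ?\<pi> u v * g v) = (\<Sum>v\<in>V. if v = T u then (if u \<in> A then c * g (T u) else 0) else 0)"
      by (intro sum.cong) auto
    also have "\<dots> = (if u \<in> A then c * g (T u) else 0)"
      using fin TB AB by (auto simp: sum.delta)
    finally show ?thesis .
  qed
  have col: "(\<Sum>u\<in>V. ?\<pi> u v) = (if v \<in> B then c else 0)" if "v \<in> V" for v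
  proof (cases "v \<in> B")
    case True
    then obtain u where u: "u \<in> A" "v = T u" using T by (auto simp: bij_betw_def)
    have "(\<Sum>u'\<in>V. ?\<pi> u' v) = (\<Sum>u'\<in>V. if u' = u then c else 0)"
      using u T by (intro sum.cong) (auto simp: bij_betw_def inj_on_def)
    also have "\<dots> = c" using fin u AB by (auto simp: sum.delta)
    finally show ?thesis using True by simp
  next
    case False
    then show ?thesis using TB by (auto intro!: sum.neutral)
  qed
  have "coupling V (\<lambda>u. if u \<in> A then c else 0) (\<lambda>v. if v \<in> B then c else 0) ?\<pi>"
    using row[of _ "\<lambda>_. 1"] col c by (auto simp: coupling_def)
  then have "W1 V E (\<lambda>u. if u \<in> A then c else 0) (\<lambda>v. if v \<in> B then c else 0)
      \<le> (\<Sum>u\<in>V. \<Sum>v\<in>V. ?\<pi> u v * real (gdist E u v))" by (rule W1_le_cost)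
  also have "\<dots> = (\<Sum>u\<in>V. if u \<in> A then c * real (gdist E u (T u)) else 0)" by (simp only: row)
  also have "\<dots> = (\<Sum>u\<in>A. c * real (gdist E u (T u)))"
    using fin AB by (subst sum.inter_restrict[symmetric]) (auto simp: Int_absorb1)
  finally show ?thesis by (simp add: sum_distrib_left)
qed

lemma mono_bounded_tendsto_at_left:
  fixes f :: "real \<Rightarrow> real"
  assumes ab: "a < b" and mono: "\<And>s t. a \<le> s \<Longrightarrow> s \<le> t \<Longrightarrow> t < b \<Longrightarrow> f s \<le> f t"
    and bound: "\<And>t. a \<le> t \<Longrightarrow> t < b \<Longrightarrow> f t \<le> B"
  shows "(f \<longlongrightarrow> (SUP t\<in>{a..<b}. f t)) (at_left b)"
proof -
  have bdd: "bdd_above (f ` {a..<b})" using bound by (intro bdd_aboveI2[of _ _ B]) auto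
  have ev: "\<forall>\<^sub>F t in at_left b. s \<le> t \<and> t < b" if "s < b" for s
    unfolding eventually_at_left_field using that by (intro exI[of _ s]) auto
  show ?thesis
  proof (rule order_tendstoI)
    fix y assume "y < (SUP t\<in>{a..<b}. f t)"
    then obtain s where s: "a \<le> s" "s < b" "y < f s"
      using ab by (subst (asm) less_cSUP_iff[OF _ bdd]) auto
    show "\<forall>\<^sub>F t in at_left b. y < f t"
      using ev[OF s(2)] by eventually_elim (use s mono in force)
  next
    fix y assume y: "(SUP t\<in>{a..<b}. f t) < y"
    show "\<forall>\<^sub>F t in at_left b. f t < y"
      using ev[OF ab]
    proof eventually_elim
      case (elim t)
      then have "f t \<le> (SUP t\<in>{a..<b}. f t)" by (intro cSUP_upper bdd) auto
      then show ?case using y by linarith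
    qed
  qed
qed

text \<open>One-step transition probabilities of the random walk on the weighted graph.\<close>

definition step_prob :: "'a set set \<Rightarrow> ('a set \<Rightarrow> real) \<Rightarrow> 'a \<Rightarrow> 'a \<Rightarrow> real" where
  "step_prob E w x z = w {x, z} / wdeg E w x"

locale connected_simple_graph =
  fixes V :: "'a set" and E :: "'a set set"
  assumes simple: "finite_simple_graph V E" and conn: "connected_graph V E" and nonempty: "E \<noteq> {}"
begin

lemma finite_V: "finite V" and finite_E: "finite E"
proof -
  show "finite V" using simple by (simp add: finite_simple_graph_def)
  then show "finite E"
    using simple by (auto simp: finite_simple_graph_def intro: finite_subset[of E "Pow V"])
qed

lemma edgeD: "{x, y} \<in> E \<Longrightarrow> x \<in> V \<and> y \<in> V \<and> x \<noteq> y"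
  using simple by (fastforce simp: finite_simple_graph_def)

lemma edgeE: assumes "e \<in> E" obtains x y where "e = {x, y}" "x \<noteq> y"
  using simple assms by (metis card_2_iff finite_simple_graph_def)

lemma nbrs_iff: "z \<in> nbrs E x \<longleftrightarrow> {x, z} \<in> E" by (simp add: nbrs_def)

lemma nbrs_subset: "nbrs E x \<subseteq> V" using edgeD by (auto simp: nbrs_def)

lemma finite_nbrs [simp]: "finite (nbrs E x)" using nbrs_subset finite_V by (rule finite_subset)

lemma not_self_nbr: "x \<notin> nbrs E x" using edgeD[of x x] by (auto simp: nbrs_def)

lemma gdist_walk: assumes "u \<in> V" "v \<in> V" shows "(u, v) \<in> adj_rel E ^^ gdist E u v"
proof -
  have "(u, v) \<in> (adj_rel E)\<^sup>*" using conn assms by (simp add: connected_graph_def)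
  then have "\<exists>n. (u, v) \<in> adj_rel E ^^ n" by (rule rtrancl_imp_relpow)
  then show ?thesis unfolding gdist_def by (rule LeastI_ex)
qed

lemma gdist_ge_1: assumes "u \<in> V" "v \<in> V" "u \<noteq> v" shows "1 \<le> gdist E u v"
  using gdist_walk[OF assms(1,2)] assms(3) by (cases "gdist E u v") auto

lemma gdist_ge_2:
  assumes "u \<in> V" "v \<in> V" "u \<noteq> v" "{u, v} \<notin> E" shows "2 \<le> gdist E u v"
proof (rule ccontr)
  assume "\<not> ?thesis"
  then have "gdist E u v = 1" using gdist_ge_1[OF assms(1-3)] by simp
  then show False using gdist_walk[OF assms(1,2)] assms(4) by (simp add: adj_rel_def)
qed

lemma gdist_self: "gdist E u u = 0"
  unfolding gdist_def by (rule Least_eq_0) simp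

lemma gdist_edge: assumes "{x, y} \<in> E" shows "gdist E x y = 1"
proof -
  have "(x, y) \<in> adj_rel E ^^ 1" using assms by (simp add: adj_rel_def)
  then have "gdist E x y \<le> 1" unfolding gdist_def by (rule Least_le)
  then show ?thesis using gdist_ge_1[of x y] edgeD[OF assms] by simp
qed

lemma constant_on_vertices:
  assumes "\<And>x y. {x, y} \<in> E \<Longrightarrow> g x = g y" "u \<in> V" "v \<in> V"
  shows "g u = g v"
proof -
  have "(u, v) \<in> (adj_rel E)\<^sup>*" using conn assms by (auto simp: connected_graph_def)
  then show ?thesis by induction (auto simp: adj_rel_def assms(1))
qed

lemma vertex_has_edge: assumes "x \<in> V" shows "nbrs E x \<noteq> {}"
proof
  assume none: "nbrs E x = {}"
  obtain a b where ab: "{a, b} \<in> E" using nonempty edgeE by (metis ex_in_conv)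
  have "(z = x) = (z' = x)" if "{z, z'} \<in> E" for z z'
    using none that by (auto simp: nbrs_def insert_commute)
  from constant_on_vertices[of "\<lambda>z. z = x", OF this, of x a] have "a = x" using assms edgeD[OF ab] by blast
  then show False using none ab by (auto simp: nbrs_def)
qed

lemma wdeg_pos: assumes "pos_weight E w" "x \<in> V" shows "0 < wdeg E w x"
  unfolding wdeg_def using assms vertex_has_edge[OF assms(2)]
  by (intro sum_pos) (auto simp: nbrs_iff pos_weight_def)

lemma sum_step_prob:
  assumes "pos_weight E w" "x \<in> V" shows "(\<Sum>z\<in>nbrs E x. step_prob E w x z) = 1"
  using wdeg_pos[OF assms] by (simp add: step_prob_def sum_divide_distrib[symmetric] wdeg_def)

lemma sum_lazy_measure:
  assumes "x \<in> V"
  shows "(\<Sum>z\<in>V. lazy_measure E w \<alpha> x z * f z)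
    = \<alpha> * f x + (1 - \<alpha>) * (\<Sum>z\<in>nbrs E x. step_prob E w x z * f z)"
proof -
  have "(\<Sum>z\<in>V. lazy_measure E w \<alpha> x z * f z)
      = (\<Sum>z\<in>insert x (nbrs E x). lazy_measure E w \<alpha> x z * f z)"
    using nbrs_subset assms finite_V
    by (intro sum.mono_neutral_right) (auto simp: lazy_measure_def)
  also have "\<dots> = \<alpha> * f x + (\<Sum>z\<in>nbrs E x. lazy_measure E w \<alpha> x z * f z)"
    using not_self_nbr by (simp add: lazy_measure_def)
  also have "(\<Sum>z\<in>nbrs E x. lazy_measure E w \<alpha> x z * f z)
      = (\<Sum>z\<in>nbrs E x. (1 - \<alpha>) * (step_prob E w x z * f z))"
    using not_self_nbr[of x] by (intro sum.cong) (auto simp: lazy_measure_def step_prob_def)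
  finally show ?thesis by (simp add: sum_distrib_left)
qed

lemma prob_mass_lazy:
  assumes "pos_weight E w" "x \<in> V" "0 \<le> \<alpha>" "\<alpha> \<le> 1"
  shows "prob_mass V (lazy_measure E w \<alpha> x)"
  unfolding prob_mass_def
proof
  show "\<forall>u\<in>V. 0 \<le> lazy_measure E w \<alpha> x u"
    using assms wdeg_pos[OF assms(1,2)]
    by (auto simp: lazy_measure_def nbrs_def pos_weight_def less_imp_le
        intro!: divide_nonneg_pos mult_nonneg_nonneg)
  show "sum (lazy_measure E w \<alpha> x) V = 1"
    using sum_lazy_measure[OF assms(2), of w \<alpha> "\<lambda>_. 1"] sum_step_prob[OF assms(1,2)] by simp
qed

text \<open>With \<open>r = (1 - t) / (1 - s)\<close>, the measure at laziness \<open>t\<close> is the mixture of the measure at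
  laziness \<open>s\<close> and the point mass at its centre, with proportions \<open>r\<close> and \<open>1 - r\<close>. Mixing a coupling with the unit transport
  from \<open>x\<close> to \<open>y\<close> in the same proportions gives \<open>1 - W\<^sub>t \<ge> r (1 - W\<^sub>s)\<close>.\<close>

lemma kappa_alpha_ratio_mono:
  assumes e: "{x, y} \<in> E" and w: "pos_weight E w" and st: "0 \<le> s" "s \<le> t" "t < 1"
  shows "kappa_alpha V E w s x y / (1 - s) \<le> kappa_alpha V E w t x y / (1 - t)"
proof -
  define r where "r = (1 - t) / (1 - s)"
  have r: "0 < r" "r \<le> 1" "1 - t = r * (1 - s)" using st by (auto simp: r_def field_simps)
  have xy: "x \<in> V" "y \<in> V" using edgeD[OF e] by auto
  have mix: "lazy_measure E w t a z = r * lazy_measure E w s a z + (1 - r) * of_bool (z = a)" for a z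
  proof -
    have "t = r * s + (1 - r)" using r(3) by (simp add: algebra_simps)
    then show ?thesis unfolding lazy_measure_def r(3) by simp
  qed
  have "(W1 V E (lazy_measure E w t x) (lazy_measure E w t y) - (1 - r)) / r
      \<le> W1 V E (lazy_measure E w s x) (lazy_measure E w s y)"
  proof (rule W1_greatest)
    fix \<pi> assume \<pi>: "coupling V (lazy_measure E w s x) (lazy_measure E w s y) \<pi>"
    let ?\<pi> = "\<lambda>u v. r * \<pi> u v + (1 - r) * (of_bool (u = x) * of_bool (v = y))"
    have one: "(\<Sum>v\<in>V. of_bool (v = a) * g v) = g a" if "a \<in> V" for a and g :: "'a \<Rightarrow> real"
      using that finite_V by (simp add: of_bool_def if_distrib[of "\<lambda>c. c * _"] sum.delta cong: if_cong)
    have one': "(\<Sum>v\<in>V. of_bool (v = a)) = (1::real)" if "a \<in> V" for a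
      using one[OF that, of "\<lambda>_. 1"] by simp
    have "coupling V (lazy_measure E w t x) (lazy_measure E w t y) ?\<pi>"
      using \<pi> r xy unfolding coupling_def mix
      by (auto simp: sum.distrib sum_distrib_left[symmetric] sum_distrib_right[symmetric] one')
    then have "W1 V E (lazy_measure E w t x) (lazy_measure E w t y)
        \<le> (\<Sum>u\<in>V. \<Sum>v\<in>V. ?\<pi> u v * real (gdist E u v))" by (rule W1_le_cost)
    also have "\<dots> = (\<Sum>u\<in>V. \<Sum>v\<in>V. r * (\<pi> u v * real (gdist E u v))
        + (1 - r) * (of_bool (u = x) * (of_bool (v = y) * real (gdist E u v))))"
      by (simp add: algebra_simps)
    also have "\<dots> = r * (\<Sum>u\<in>V. \<Sum>v\<in>V. \<pi> u v * real (gdist E u v)) + (1 - r) * real (gdist E x y)"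
      using xy by (simp add: sum.distrib sum_distrib_left[symmetric] one)
    finally show "(W1 V E (lazy_measure E w t x) (lazy_measure E w t y) - (1 - r)) / r
        \<le> (\<Sum>u\<in>V. \<Sum>v\<in>V. \<pi> u v * real (gdist E u v))"
      using r gdist_edge[OF e] by (simp add: field_simps)
  qed (use prob_mass_lazy w xy st in auto)
  then have "r * kappa_alpha V E w s x y \<le> kappa_alpha V E w t x y"
    using r by (simp add: kappa_alpha_def field_simps)
  then have "kappa_alpha V E w s x y \<le> kappa_alpha V E w t x y / r"
    using r by (simp add: field_simps)
  then have "kappa_alpha V E w s x y / (1 - s) \<le> kappa_alpha V E w t x y / r / (1 - s)"
    using st by (intro divide_right_mono) auto
  then show ?thesis by (simp add: r(3))
qed

text \<open>The curvature is the limit of a monotone bounded function, hence its supremum. One laziness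
  is enough for a lower bound, whereas an upper bound must hold for all of them. Some upper bound \<open>B\<close>
  is needed even for the second part: without it the limit is not known to exist.\<close>

lemma kappa_LLY_bounds:
  assumes e: "{x, y} \<in> E" and w: "pos_weight E w"
    and B: "\<And>\<alpha>. 0 \<le> \<alpha> \<Longrightarrow> \<alpha> < 1 \<Longrightarrow> kappa_alpha V E w \<alpha> x y \<le> (1 - \<alpha>) * B"
  shows "kappa_LLY V E w x y \<le> B"
    and "0 \<le> \<alpha> \<Longrightarrow> \<alpha> < 1 \<Longrightarrow> kappa_alpha V E w \<alpha> x y / (1 - \<alpha>) \<le> kappa_LLY V E w x y"
proof -
  let ?f = "\<lambda>\<alpha>. kappa_alpha V E w \<alpha> x y / (1 - \<alpha>)"
  have bound: "?f \<alpha> \<le> B" if "0 \<le> \<alpha>" "\<alpha> < 1" for \<alpha>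
    using B[OF that] that by (simp add: field_simps)
  have "(?f \<longlongrightarrow> (SUP t\<in>{0..<1}. ?f t)) (at_left 1)"
    using kappa_alpha_ratio_mono[OF e w] bound
    by (intro mono_bounded_tendsto_at_left[where B = B]) auto
  then have sup: "kappa_LLY V E w x y = (SUP t\<in>{0..<1}. ?f t)"
    unfolding kappa_LLY_def by (intro tendsto_Lim) (auto simp: trivial_limit_at_left_real)
  show "kappa_LLY V E w x y \<le> B"
    unfolding sup using bound by (intro cSUP_least) auto
  show "?f \<alpha> \<le> kappa_LLY V E w x y" if "0 \<le> \<alpha>" "\<alpha> < 1"
    unfolding sup using bound that by (intro cSUP_upper bdd_aboveI2[of _ _ B]) auto
qed

end

section \<open>Edge flow and the maximum average degree\<close>

text \<open>The probability that the random walk crosses \<open>e\<close> when started at one endpoint, added over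
  both endpoints.\<close>

definition edge_flow :: "'a set set \<Rightarrow> ('a set \<Rightarrow> real) \<Rightarrow> 'a set \<Rightarrow> real" where
  "edge_flow E w e = (\<Sum>x\<in>e. w e / wdeg E w x)"

context connected_simple_graph
begin

lemma edge_flow_edge: "{x, y} \<in> E \<Longrightarrow> edge_flow E w {x, y} = step_prob E w x y + step_prob E w y x"
  using edgeD[of x y] by (simp add: edge_flow_def step_prob_def insert_commute)

lemma wdeg_eq_sum_incident: "wdeg E w x = (\<Sum>e\<in>{e \<in> E. x \<in> e}. w e)"
proof -
  have "bij_betw (\<lambda>z. {x, z}) (nbrs E x) {e \<in> E. x \<in> e}"
    unfolding bij_betw_def
  proof
    show "inj_on (\<lambda>z. {x, z}) (nbrs E x)" by (auto simp: inj_on_def doubleton_eq_iff)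
    show "(\<lambda>z. {x, z}) ` nbrs E x = {e \<in> E. x \<in> e}"
    proof
      show "{e \<in> E. x \<in> e} \<subseteq> (\<lambda>z. {x, z}) ` nbrs E x"
      proof
        fix e assume e: "e \<in> {e \<in> E. x \<in> e}"
        then obtain a b where ab: "e = {a, b}" using edgeE by blast
        then have "e = {x, if x = a then b else a}" using e by auto
        then show "e \<in> (\<lambda>z. {x, z}) ` nbrs E x" using e by (auto simp: nbrs_iff)
      qed
    qed (auto simp: nbrs_iff)
  qed
  then show ?thesis unfolding wdeg_def by (rule sum.reindex_bij_betw)
qed

text \<open>Double counting of the pairs of an edge and one of its endpoints: the inner sum on the right is the share of
  the weighted degree of \<open>x\<close> that lies on \<open>E'\<close>.\<close>

lemma sum_edge_flow:
  assumes "V' \<subseteq> V" "E' \<subseteq> E" "\<forall>e\<in>E'. e \<subseteq> V'"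
  shows "(\<Sum>e\<in>E'. edge_flow E w e) = (\<Sum>x\<in>V'. (\<Sum>e\<in>{e \<in> E'. x \<in> e}. w e) / wdeg E w x)"
proof -
  have fin: "finite V'" "finite E'" using assms finite_V finite_E finite_subset by blast+
  have "(\<Sum>e\<in>E'. edge_flow E w e) = (\<Sum>e\<in>E'. \<Sum>x\<in>{x \<in> V'. x \<in> e}. w e / wdeg E w x)"
    unfolding edge_flow_def using assms(3) by (intro sum.cong) auto
  also have "\<dots> = (\<Sum>x\<in>V'. \<Sum>e\<in>{e \<in> E'. x \<in> e}. w e / wdeg E w x)"
    by (rule sum.swap_restrict[OF fin(2,1)])
  finally show ?thesis by (simp add: sum_divide_distrib)
qed

lemma incident_share_le_1:
  assumes w: "pos_weight E w" and "x \<in> V" "E' \<subseteq> E"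
  shows "(\<Sum>e\<in>{e \<in> E'. x \<in> e}. w e) / wdeg E w x \<le> 1"
proof -
  have "(\<Sum>e\<in>{e \<in> E'. x \<in> e}. w e) \<le> wdeg E w x"
    unfolding wdeg_eq_sum_incident using finite_E assms
    by (intro sum_mono2) (auto simp: pos_weight_def less_imp_le)
  then show ?thesis using wdeg_pos[OF w assms(2)] by simp
qed

lemma sum_edge_flow_le_card:
  assumes w: "pos_weight E w" and sub: "V' \<subseteq> V" "E' \<subseteq> E" "\<forall>e\<in>E'. e \<subseteq> V'"
  shows "(\<Sum>e\<in>E'. edge_flow E w e) \<le> real (card V')"
proof -
  have "(\<Sum>e\<in>E'. edge_flow E w e) \<le> (\<Sum>x\<in>V'. 1)"
    unfolding sum_edge_flow[OF sub] using incident_share_le_1[OF w] sub by (intro sum_mono) auto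
  then show ?thesis by simp
qed

lemma sum_edge_flow_all:
  assumes w: "pos_weight E w"
  shows "(\<Sum>e\<in>E. edge_flow E w e) = real (card V)"
proof -
  have "(\<Sum>e\<in>E. edge_flow E w e) = (\<Sum>x\<in>V. wdeg E w x / wdeg E w x)"
    unfolding wdeg_eq_sum_incident[symmetric]
    by (subst sum_edge_flow[of V E]) (use simple in \<open>auto simp: finite_simple_graph_def wdeg_eq_sum_incident\<close>)
  also have "\<dots> = (\<Sum>x\<in>V. 1)" using wdeg_pos[OF w] by (intro sum.cong) force+
  finally show ?thesis by simp
qed

lemma finite_densities:
  "finite {2 * real (card E') / real (card V') | V' E'.
     V' \<noteq> {} \<and> V' \<subseteq> V \<and> E' \<subseteq> E \<and> (\<forall>e\<in>E'. e \<subseteq> V')}" (is "finite ?D")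
proof (rule finite_subset)
  show "?D \<subseteq> (\<lambda>(V', E'). 2 * real (card E') / real (card V')) ` (Pow V \<times> Pow E)" by auto
  show "finite ((\<lambda>(V', E'). 2 * real (card E') / real (card V')) ` (Pow V \<times> Pow E))"
    using finite_V finite_E by simp
qed

lemma mad_ge:
  assumes "V' \<noteq> {}" "V' \<subseteq> V" "E' \<subseteq> E" "\<forall>e\<in>E'. e \<subseteq> V'"
  shows "2 * real (card E') / real (card V') \<le> mad V E"
  unfolding mad_def by (rule Max_ge[OF finite_densities]) (use assms in blast)

lemma mad_attained:
  obtains V' E' where "V' \<noteq> {}" "V' \<subseteq> V" "E' \<subseteq> E" "\<forall>e\<in>E'. e \<subseteq> V'"
    "mad V E = 2 * real (card E') / real (card V')"
proof -
  have "mad V E \<in> {2 * real (card E') / real (card V') | V' E'.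
     V' \<noteq> {} \<and> V' \<subseteq> V \<and> E' \<subseteq> E \<and> (\<forall>e\<in>E'. e \<subseteq> V')}" (is "_ \<in> ?D")
    unfolding mad_def
  proof (rule Max_in[OF finite_densities])
    have "2 * real (card {}) / real (card V) \<in> ?D"
      using conn by (intro CollectI exI[of _ V] exI[of _ "{}"]) (auto simp: connected_graph_def)
    then show "?D \<noteq> {}" by blast
  qed
  then show thesis using that by blast
qed

lemma mad_pos: "0 < mad V E"
proof -
  obtain x y where e: "{x, y} \<in> E" using nonempty edgeE by (metis ex_in_conv)
  have "2 * real (card {{x, y}}) / real (card {x, y}) \<le> mad V E"
    using e edgeD[OF e] by (intro mad_ge) auto
  then show ?thesis using edgeD[OF e] by simp
qed

lemma regular_degree_pos:
  assumes "regular_graph V E d" shows "0 < d"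
proof -
  obtain x where "x \<in> V" using conn by (auto simp: connected_graph_def)
  then show ?thesis
    using assms vertex_has_edge[of x] by (auto simp: regular_graph_def card_gt_0_iff)
qed

text \<open>For unit weights every edge of a \<open>d\<close>-regular graph has flow \<open>2 / d\<close>, so the bounds on the
  total flow are statements about density: equality for the whole graph, an inequality for its
  subgraphs.\<close>

lemma mad_regular:
  assumes reg: "regular_graph V E d" shows "mad V E = real d"
proof -
  have w: "pos_weight E (\<lambda>_. 1)" by (simp add: pos_weight_def)
  have dpos: "0 < d" by (rule regular_degree_pos[OF reg])
  have flow: "edge_flow E (\<lambda>_. 1) e = 2 / real d" if "e \<in> E" for e
  proof -
    obtain x y where xy: "e = {x, y}" using edgeE[OF \<open>e \<in> E\<close>] .
    then show ?thesis
      using reg that edgeD[of x y]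
      by (simp add: edge_flow_edge step_prob_def wdeg_def regular_graph_def)
  qed
  have sum: "(\<Sum>e\<in>E'. edge_flow E (\<lambda>_. 1) e) = 2 * real (card E') / real d" if "E' \<subseteq> E" for E'
  proof -
    have "(\<Sum>e\<in>E'. edge_flow E (\<lambda>_. 1) e) = (\<Sum>e\<in>E'. 2 / real d)"
      using flow that by (intro sum.cong) auto
    then show ?thesis by simp
  qed
  obtain V' E' where H: "V' \<noteq> {}" "V' \<subseteq> V" "E' \<subseteq> E" "\<forall>e\<in>E'. e \<subseteq> V'"
    "mad V E = 2 * real (card E') / real (card V')" by (rule mad_attained)
  have "card V' \<noteq> 0" using H finite_V finite_subset by (metis card_0_eq)
  moreover have "2 * real (card E') \<le> real d * real (card V')"
    using sum_edge_flow_le_card[OF w H(2-4)] sum[OF H(3)] dpos by (simp add: field_simps)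
  ultimately have "mad V E \<le> real d" unfolding H(5) by (simp add: divide_le_eq)
  moreover have "V \<noteq> {}" using conn by (auto simp: connected_graph_def)
  moreover have "real d \<le> mad V E"
  proof -
    have "card V \<noteq> 0" using \<open>V \<noteq> {}\<close> finite_V by simp
    then have "2 * real (card E) / real (card V) = real d"
      using sum_edge_flow_all[OF w] sum[of E] dpos by (simp add: field_simps)
    then show ?thesis
      using mad_ge[of V E] \<open>V \<noteq> {}\<close> simple by (auto simp: finite_simple_graph_def)
  qed
  ultimately show ?thesis by simp
qed

lemma shows kappa_LLY_graph_le: "{x, y} \<in> E \<Longrightarrow> kappa_LLY_graph V E w \<le> kappa_LLY V E w x y"
    and kappa_LLY_graph_greatest:
      "(\<And>x y. {x, y} \<in> E \<Longrightarrow> c \<le> kappa_LLY V E w x y) \<Longrightarrow> c \<le> kappa_LLY_graph V E w"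
proof -
  let ?K = "{kappa_LLY V E w x y | x y. {x, y} \<in> E}"
  have "?K \<subseteq> (\<lambda>(x, y). kappa_LLY V E w x y) ` (V \<times> V)" using edgeD by fast
  then have fin: "finite ?K" using finite_V by (meson finite_SigmaI finite_imageI finite_subset)
  show "{x, y} \<in> E \<Longrightarrow> kappa_LLY_graph V E w \<le> kappa_LLY V E w x y"
    unfolding kappa_LLY_graph_def by (rule Min_le[OF fin]) blast
  obtain x y where "{x, y} \<in> E" using nonempty edgeE by (metis ex_in_conv)
  then have "?K \<noteq> {}" by blast
  then show "c \<le> kappa_LLY_graph V E w" if "\<And>x y. {x, y} \<in> E \<Longrightarrow> c \<le> kappa_LLY V E w x y"
    unfolding kappa_LLY_graph_def using that by (subst Min_ge_iff[OF fin]) auto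
qed

end

section \<open>Curvature bounds from girth\<close>

locale girth_graph = connected_simple_graph +
  fixes l :: nat
  assumes l: "l \<in> {4, 5}" and girth: "girth E \<ge> enat l"
begin

lemma cycle_length_ge: assumes "is_cycle E c" shows "l \<le> length c"
proof -
  have "girth E \<le> enat (length c)"
    unfolding girth_def by (rule INF_lower) (use assms in simp)
  then show ?thesis using girth by (metis enat_ord_simps(1) order_trans)
qed

lemma no_triangle: "{x, y} \<in> E \<Longrightarrow> {y, z} \<in> E \<Longrightarrow> {x, z} \<notin> E"
proof
  assume *: "{x, y} \<in> E" "{y, z} \<in> E" "{x, z} \<in> E"
  have "is_cycle E [x, y, z]"
    using * edgeD[OF *(1)] edgeD[OF *(2)] edgeD[OF *(3)]
    by (auto simp: is_cycle_def less_Suc_eq insert_commute)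
  then show False using cycle_length_ge[of "[x, y, z]"] l by auto
qed

lemma aux_part_iff: "u \<in> aux_part E x y \<longleftrightarrow> {x, u} \<in> E \<and> u \<noteq> y"
  by (auto simp: aux_part_def nbrs_def)

lemma finite_aux_part [simp]: "finite (aux_part E x y)" by (simp add: aux_part_def)

lemma aux_parts_disjoint: "{x, y} \<in> E \<Longrightarrow> aux_part E x y \<inter> aux_part E y x = {}"
  using no_triangle by (auto simp: aux_part_iff insert_commute)

text \<open>Two vertices of \<open>X\<close> and \<open>Y\<close> that coincide or, for \<open>l = 5\<close>, are adjacent close up a cycle
  of length 3 or 4 through the edge \<open>xy\<close>.\<close>

lemma gdist_across:
  assumes e: "{x, y} \<in> E" and u: "u \<in> aux_part E x y" and v: "v \<in> aux_part E y x"
  shows "l - 3 \<le> gdist E u v"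
proof -
  have edges: "{x, u} \<in> E" "{y, v} \<in> E" "u \<noteq> y" "v \<noteq> x" using u v by (auto simp: aux_part_iff)
  have ne: "u \<noteq> v" using aux_parts_disjoint[OF e] u v by blast
  have V: "u \<in> V" "v \<in> V" using edgeD[OF edges(1)] edgeD[OF edges(2)] by auto
  show ?thesis
  proof (cases "{u, v} \<in> E")
    case True
    have "is_cycle E [u, x, y, v]"
      using e edges True ne edgeD[OF edges(1)] edgeD[OF edges(2)] edgeD[OF e]
      by (auto simp: is_cycle_def less_Suc_eq insert_commute)
    then have "l = 4" using cycle_length_ge[of "[u, x, y, v]"] l by auto
    then show ?thesis using gdist_ge_1[OF V ne] by simp
  next
    case False
    then show ?thesis using gdist_ge_2[OF V ne] l by auto
  qed
qed

lemma gdist_aux_part_far: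
  assumes e: "{x, y} \<in> E" and v: "v \<in> aux_part E y x"
  shows "2 \<le> gdist E x v" and "2 \<le> gdist E v x"
proof -
  have "{y, v} \<in> E" "v \<noteq> x" using v by (auto simp: aux_part_iff)
  moreover have "{x, v} \<notin> E" using no_triangle[OF e] calculation by blast
  ultimately show "2 \<le> gdist E x v" "2 \<le> gdist E v x"
    using edgeD[OF e] edgeD[of y v] by (auto intro!: gdist_ge_2 simp: insert_commute)
qed

lemma sum_nbrs_split:
  fixes g :: "'a \<Rightarrow> real"
  assumes "{x, y} \<in> E"
  shows "(\<Sum>z\<in>nbrs E x. g z) = g y + (\<Sum>z\<in>aux_part E x y. g z)"
  unfolding aux_part_def using assms by (intro sum.remove) (auto simp: nbrs_iff)

text \<open>The upper bound produced by the potential \<open>f\<close> with \<open>f x = 0\<close>, \<open>f y = 1\<close>, value \<open>-1\<close> on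
  \<open>S\<close>, \<open>0\<close> on the rest of \<open>X\<close>, \<open>l - 4\<close> on \<open>N\<close> and \<open>l - 3\<close> on the rest of \<open>Y\<close>. Its increments from \<open>X\<close>
  to \<open>Y\<close> are at most \<open>l - 3\<close>, the least possible distance, except from \<open>S\<close> to the complement of \<open>N\<close>,
  where the increment is \<open>l - 2\<close>. The separation hypothesis excludes exactly the offending distance
  \<open>l - 3\<close> there.\<close>

lemma kappa_alpha_le_test:
  assumes e: "{x, y} \<in> E" and w: "pos_weight E w" and \<alpha>: "0 \<le> \<alpha>" "\<alpha> < 1"
    and S: "S \<subseteq> aux_part E x y" and N: "N \<subseteq> aux_part E y x"
    and sep: "\<And>u v. u \<in> S \<Longrightarrow> v \<in> aux_part E y x - N \<Longrightarrow> gdist E u v \<noteq> l - 3"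
  shows "kappa_alpha V E w \<alpha> x y \<le> (1 - \<alpha>) * (1 + step_prob E w x y - (\<Sum>u\<in>S. step_prob E w x u)
    - (real l - 3) * (1 - step_prob E w y x) + (\<Sum>v\<in>N. step_prob E w y v))"
proof -
  let ?X = "aux_part E x y" and ?Y = "aux_part E y x"
  let ?p = "step_prob E w x" and ?q = "step_prob E w y"
  have e': "{y, x} \<in> E" using e by (simp add: insert_commute)
  have xy: "x \<in> V" "y \<in> V" "x \<noteq> y" using edgeD[OF e] by auto
  define f where "f z = (if z = y then 1 else if z \<in> S then -1 else if z \<in> N then real l - 4
    else if z \<in> ?Y then real l - 3 else 0)" for z
  have notin: "x \<notin> ?X" "x \<notin> ?Y" "y \<notin> ?X" "y \<notin> ?Y"
    using xy edgeD[of x x] edgeD[of y y] by (auto simp: aux_part_iff)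
  have disj: "?X \<inter> ?Y = {}" by (rule aux_parts_disjoint[OF e])
  have fx: "f x = 0" and fy: "f y = 1" using xy notin S N by (auto simp: f_def)
  have fX: "f u = (if u \<in> S then -1 else 0)" if "u \<in> ?X" for u
    using that notin disj N by (auto simp: f_def)
  have fY: "f v = (if v \<in> N then real l - 4 else real l - 3)" if "v \<in> ?Y" for v
    using that notin disj S by (auto simp: f_def)
  \<comment> \<open>only a source in the closed neighbourhood of \<open>x\<close> and a target in that of \<open>y\<close> matter\<close>
  have lip: "f v - f u \<le> real (gdist E u v)"
    if u: "u = x \<or> u = y \<or> u \<in> ?X" and v: "v = x \<or> v = y \<or> v \<in> ?Y" for u v
  proof (cases "u \<in> ?X")
    case uX: True
    have uV: "u \<in> V" "u \<noteq> x" "u \<noteq> y" using uX edgeD[of x u] by (auto simp: aux_part_iff)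
    from v consider "v = x" | "v = y" | "v \<in> ?Y" by blast
    then show ?thesis
    proof cases
      case 1
      then show ?thesis using gdist_ge_1[OF uV(1) xy(1) uV(2)] fX[OF uX] fx by auto
    next
      case 2
      then show ?thesis using gdist_aux_part_far(2)[OF e' uX] fX[OF uX] fy by auto
    next
      case vY: 3
      have d: "l - 3 \<le> gdist E u v" using gdist_across[OF e uX vY] .
      show ?thesis
      proof (cases "u \<in> S \<and> v \<notin> N")
        case True
        then have "l - 2 \<le> gdist E u v" using d sep[of u v] vY l by auto
        then show ?thesis using fX[OF uX] fY[OF vY] True l by auto
      next
        case False
        then show ?thesis using fX[OF uX] fY[OF vY] d l by auto
      qed
    qed
  next
    case False
    then have uxy: "u = x \<or> u = y" using u by blast
    from v consider "v = x" | "v = y" | "v \<in> ?Y" by blast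
    then show ?thesis
    proof cases
      case 1
      then show ?thesis using uxy fx fy by auto
    next
      case 2
      then show ?thesis using uxy fx fy gdist_edge[OF e] by auto
    next
      case vY: 3
      have "v \<in> V" "v \<noteq> y" using vY edgeD[of y v] by (auto simp: aux_part_iff)
      then have "1 \<le> gdist E y v" using gdist_ge_1 xy by auto
      then show ?thesis using uxy fx fy fY[OF vY] gdist_aux_part_far(1)[OF e vY] l by auto
    qed
  qed
  have supp: "z = a \<or> z = b \<or> z \<in> aux_part E a b" if "lazy_measure E w \<alpha> a z \<noteq> 0" for a b z
    using that by (auto simp: lazy_measure_def aux_part_def split: if_splits)
  have "(\<Sum>v\<in>V. lazy_measure E w \<alpha> y v * f v) - (\<Sum>u\<in>V. lazy_measure E w \<alpha> x u * f u)
      \<le> W1 V E (lazy_measure E w \<alpha> x) (lazy_measure E w \<alpha> y)"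
  proof (rule W1_ge_potential[OF finite_V])
    fix u v assume "lazy_measure E w \<alpha> x u \<noteq> 0" "lazy_measure E w \<alpha> y v \<noteq> 0"
    then show "f v - f u \<le> real (gdist E u v)"
      using supp[of x u y] supp[of y v x] by (intro lip) auto
  qed (use prob_mass_lazy w xy \<alpha> in auto)
  also have "(\<Sum>v\<in>V. lazy_measure E w \<alpha> y v * f v) = \<alpha> + (1 - \<alpha>) * (\<Sum>v\<in>?Y. ?q v * f v)"
    using xy by (simp add: sum_lazy_measure sum_nbrs_split[OF e'] fx fy)
  also have "(\<Sum>v\<in>?Y. ?q v * f v) = (\<Sum>v\<in>?Y. (real l - 3) * ?q v - (if v \<in> N then ?q v else 0))"
    by (intro sum.cong) (auto simp: fY algebra_simps)
  also have "\<dots> = (real l - 3) * (\<Sum>v\<in>?Y. ?q v) - (\<Sum>v\<in>N. ?q v)"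
    using N by (simp add: sum_subtractf sum_distrib_left sum.inter_restrict[symmetric] Int_absorb1)
  also have "(\<Sum>v\<in>?Y. ?q v) = 1 - ?q x"
    using sum_step_prob[OF w xy(2)] sum_nbrs_split[OF e', of ?q] by simp
  also have "(\<Sum>u\<in>V. lazy_measure E w \<alpha> x u * f u) = (1 - \<alpha>) * (?p y + (\<Sum>u\<in>?X. ?p u * f u))"
    using xy by (simp add: sum_lazy_measure sum_nbrs_split[OF e] fx fy)
  also have "(\<Sum>u\<in>?X. ?p u * f u) = (\<Sum>u\<in>?X. if u \<in> S then - ?p u else 0)"
    by (intro sum.cong) (auto simp: fX)
  also have "(\<Sum>u\<in>?X. if u \<in> S then - ?p u else 0) = - (\<Sum>u\<in>S. ?p u)"
    using S by (simp add: sum.inter_restrict[symmetric] Int_absorb1 sum_negf)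
  finally show ?thesis by (simp add: kappa_alpha_def algebra_simps)
qed

lemma kappa_LLY_le_test:
  assumes "{x, y} \<in> E" "pos_weight E w" "S \<subseteq> aux_part E x y" "N \<subseteq> aux_part E y x"
    and "\<And>u v. u \<in> S \<Longrightarrow> v \<in> aux_part E y x - N \<Longrightarrow> gdist E u v \<noteq> l - 3"
  shows "kappa_LLY V E w x y \<le> 1 + step_prob E w x y - (\<Sum>u\<in>S. step_prob E w x u)
    - (real l - 3) * (1 - step_prob E w y x) + (\<Sum>v\<in>N. step_prob E w y v)"
  by (rule kappa_LLY_bounds(1)[OF assms(1,2)]) (rule kappa_alpha_le_test, use assms in auto)

text \<open>Any instance of the test bound shows that the limit exists.\<close>

lemma kappa_LLY_ge_ratio:
  assumes "{x, y} \<in> E" "pos_weight E w" "0 \<le> \<alpha>" "\<alpha> < 1"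
  shows "kappa_alpha V E w \<alpha> x y / (1 - \<alpha>) \<le> kappa_LLY V E w x y"
  by (rule kappa_LLY_bounds(2)[OF assms(1,2) _ assms(3,4)])
    (rule kappa_alpha_le_test[of _ _ _ _ "{}" "aux_part E y x"], use assms in auto)

text \<open>The coarsest test sets \<open>S = X\<close> and \<open>N = Y\<close>. The bound is not symmetric in \<open>x\<close> and \<open>y\<close>, and
  this asymmetry later forces the two transition probabilities to agree.\<close>

lemma kappa_LLY_le_step_prob:
  assumes e: "{x, y} \<in> E" and w: "pos_weight E w"
  shows "kappa_LLY V E w x y \<le> 2 * step_prob E w x y - (real l - 4) * (1 - step_prob E w y x)"
proof -
  have e': "{y, x} \<in> E" using e by (simp add: insert_commute)
  have xy: "x \<in> V" "y \<in> V" using edgeD[OF e] by auto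
  have "(\<Sum>u\<in>aux_part E x y. step_prob E w x u) = 1 - step_prob E w x y"
    "(\<Sum>v\<in>aux_part E y x. step_prob E w y v) = 1 - step_prob E w y x"
    using sum_step_prob[OF w xy(1)] sum_nbrs_split[OF e, of "step_prob E w x"]
      sum_step_prob[OF w xy(2)] sum_nbrs_split[OF e', of "step_prob E w y"] by auto
  then show ?thesis
    using kappa_LLY_le_test[OF e w order_refl order_refl] by (simp add: algebra_simps)
qed

text \<open>At laziness \<open>c = 1 / (d + 1)\<close> the mass kept at a vertex equals the mass sent to each of its neighbours, so
  both measures are uniform with density \<open>c\<close>. The bijection fixing \<open>x\<close> and \<open>y\<close> and following
  the matching costs \<open>c (d - 1) (l - 3)\<close>.\<close>

lemma kappa_LLY_ge_of_matching:
  assumes reg: "regular_graph V E d" and e: "{x, y} \<in> E"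
    and m: "bij_betw m (aux_part E x y) (aux_part E y x)"
    and dist: "\<And>u. u \<in> aux_part E x y \<Longrightarrow> gdist E u (m u) = l - 3"
  shows "4 - real l + (real l - 2) / real d \<le> kappa_LLY V E (\<lambda>_. 1) x y"
proof -
  let ?X = "aux_part E x y" and ?Y = "aux_part E y x"
  have e': "{y, x} \<in> E" using e by (simp add: insert_commute)
  have xy: "x \<in> V" "y \<in> V" "x \<noteq> y" using edgeD[OF e] by auto
  have w: "pos_weight E (\<lambda>_. 1)" by (simp add: pos_weight_def)
  have deg: "card (nbrs E a) = d" if "a \<in> V" for a using reg that by (simp add: regular_graph_def)
  have dpos: "0 < d" using deg[OF xy(1)] vertex_has_edge[OF xy(1)] by (metis card_gt_0_iff finite_nbrs)
  have cardX: "real (card ?X) = real d - 1"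
    using deg[OF xy(1)] dpos e by (simp add: aux_part_def nbrs_iff of_nat_diff)
  define c where "c = 1 / (real d + 1)"
  have c: "0 < c" "c < 1" "1 - c = d * c" using dpos by (auto simp: c_def field_simps)
  have mu: "lazy_measure E (\<lambda>_. 1) c a = (\<lambda>u. if u \<in> insert a (nbrs E a) then c else 0)" if "a \<in> V" for a
    using deg[OF that] c dpos by (auto simp: lazy_measure_def wdeg_def fun_eq_iff)
  have notin: "x \<notin> ?X" "x \<notin> ?Y" "y \<notin> ?X" "y \<notin> ?Y"
    using xy edgeD[of x x] edgeD[of y y] by (auto simp: aux_part_iff)
  have ball: "insert x (nbrs E x) = insert x (insert y ?X)" "insert y (nbrs E y) = insert x (insert y ?Y)"
    using e e' by (auto simp: aux_part_def nbrs_iff)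
  \<comment> \<open>the transport map; both measures have the same mass at \<open>x\<close> and at \<open>y\<close>, which stay in place\<close>
  define T where "T u = (if u = x \<or> u = y then u else m u)" for u
  have "bij_betw T ?X ?Y"
    using m notin by (subst bij_betw_cong[of _ _ m]) (auto simp: T_def)
  then have "bij_betw T ({x, y} \<union> ?X) ({x, y} \<union> ?Y)"
    using notin by (intro bij_betw_combine) (auto simp: bij_betw_def inj_on_def T_def)
  then have T: "bij_betw T (insert x (nbrs E x)) (insert y (nbrs E y))"
    by (simp add: ball)
  have "W1 V E (lazy_measure E (\<lambda>_. 1) c x) (lazy_measure E (\<lambda>_. 1) c y)
      \<le> c * (\<Sum>u\<in>insert x (nbrs E x). real (gdist E u (T u)))"
    unfolding mu[OF xy(1)] mu[OF xy(2)]
    by (rule W1_uniform_le_bij[OF finite_V T]) (use nbrs_subset xy c in auto)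
  also have "(\<Sum>u\<in>insert x (nbrs E x). real (gdist E u (T u)))
      = (\<Sum>u\<in>?X. real (gdist E u (T u)))"
    unfolding ball using notin xy by (simp add: T_def gdist_self)
  also have "\<dots> = (\<Sum>u\<in>?X. real (l - 3))"
    using notin dist by (intro sum.cong) (auto simp: T_def)
  also have "\<dots> = (real d - 1) * (real l - 3)" using cardX l by auto
  finally have "1 - c * ((real d - 1) * (real l - 3)) \<le> kappa_alpha V E (\<lambda>_. 1) c x y"
    by (simp add: kappa_alpha_def)
  then have "(1 - c * ((real d - 1) * (real l - 3))) / (1 - c) \<le> kappa_alpha V E (\<lambda>_. 1) c x y / (1 - c)"
    using c by (intro divide_right_mono) auto
  also have "\<dots> \<le> kappa_LLY V E (\<lambda>_. 1) x y"
    using c by (intro kappa_LLY_ge_ratio[OF e w]) auto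
  also have "(1 - c * ((real d - 1) * (real l - 3))) / (1 - c) = 4 - real l + (real l - 2) / real d"
  proof -
    have "(real d + 1) * c = 1" by (simp add: c_def)
    then have "1 - c * ((real d - 1) * (real l - 3)) = c * (real d * (4 - real l) + (real l - 2))"
      by algebra
    then have "(1 - c * ((real d - 1) * (real l - 3))) / (1 - c)
        = (real d * (4 - real l) + (real l - 2)) / real d"
      using c(1) by (simp only: c(3)) simp
    then show ?thesis using dpos by (simp add: add_divide_distrib)
  qed
  finally show ?thesis .
qed

end

section \<open>The bound and its extremal weights\<close>

context girth_graph
begin

text \<open>The mean of the bounds of \<open>kappa_LLY_le_step_prob\<close> for the two orientations of the edge.\<close>

lemma edge_flow_ge:
  assumes w: "pos_weight E w" and e: "e \<in> E"
  shows "2 * (kappa_LLY_graph V E w - (4 - real l)) \<le> (real l - 2) * edge_flow E w e"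
proof -
  obtain x y where xy: "e = {x, y}" using edgeE[OF e] .
  then have "{x, y} \<in> E" "{y, x} \<in> E" using e by (auto simp: insert_commute)
  then show ?thesis
    using kappa_LLY_graph_le[of x y w] kappa_LLY_graph_le[of y x w]
      kappa_LLY_le_step_prob[OF _ w, of x y] kappa_LLY_le_step_prob[OF _ w, of y x]
    by (simp add: xy edge_flow_edge algebra_simps)
qed

lemma kappa_LLY_graph_le_mad:
  assumes w: "pos_weight E w"
  shows "kappa_LLY_graph V E w \<le> 4 - real l + (real l - 2) / mad V E"
proof -
  let ?k = "kappa_LLY_graph V E w - (4 - real l)"
  obtain V' E' where H: "V' \<noteq> {}" "V' \<subseteq> V" "E' \<subseteq> E" "\<forall>e\<in>E'. e \<subseteq> V'"
    "mad V E = 2 * real (card E') / real (card V')" by (rule mad_attained)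
  have V': "0 < real (card V')" using H finite_V finite_subset by (metis card_gt_0_iff of_nat_0_less_iff)
  have "2 * ?k * real (card E') = (\<Sum>e\<in>E'. 2 * ?k)" by simp
  also have "\<dots> \<le> (\<Sum>e\<in>E'. (real l - 2) * edge_flow E w e)"
    using edge_flow_ge[OF w] H(3) by (intro sum_mono) auto
  also have "\<dots> = (real l - 2) * (\<Sum>e\<in>E'. edge_flow E w e)" by (simp add: sum_distrib_left)
  also have "\<dots> \<le> (real l - 2) * real (card V')"
    using sum_edge_flow_le_card[OF w H(2-4)] l by (intro mult_left_mono) auto
  finally have "?k * mad V E \<le> real l - 2"
    unfolding H(5) using V' by (simp add: field_simps)
  then have "?k \<le> (real l - 2) / mad V E" using mad_pos by (simp add: pos_le_divide_eq)
  then show ?thesis by simp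
qed

text \<open>Equality in the averaging argument over a densest subgraph \<open>(V', E')\<close>: every vertex of \<open>V'\<close>
  spends its whole weighted degree on \<open>E'\<close>, so \<open>V'\<close> is closed under adjacency and equals \<open>V\<close>. All
  edges then have the same flow, and the two bounds of \<open>kappa_LLY_le_step_prob\<close> for an edge differ by
  \<open>(6 - l) (p - q)\<close> while their mean is already attained, whence \<open>p = q\<close>.\<close>

lemma extremal_weight:
  assumes w: "pos_weight E w"
    and eq: "kappa_LLY_graph V E w = 4 - real l + (real l - 2) / mad V E"
  obtains d c where "regular_graph V E d"
    and "\<And>x y. {x, y} \<in> E \<Longrightarrow> step_prob E w x y = 1 / real d"
    and "\<And>e. e \<in> E \<Longrightarrow> w e = c"
proof -
  let ?m = "mad V E"
  have m: "0 < ?m" by (rule mad_pos)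
  have l2: "0 < real l - 2" using l by auto
  have flow_ge: "2 / ?m \<le> edge_flow E w e" if "e \<in> E" for e
  proof -
    have "(real l - 2) * (2 / ?m) \<le> (real l - 2) * edge_flow E w e"
      using edge_flow_ge[OF w that] eq by (simp add: algebra_simps)
    then show ?thesis using l2 by (simp only: mult_le_cancel_left_pos)
  qed
  obtain V' E' where H: "V' \<noteq> {}" "V' \<subseteq> V" "E' \<subseteq> E" "\<forall>e\<in>E'. e \<subseteq> V'"
    "?m = 2 * real (card E') / real (card V')" by (rule mad_attained)
  have fin: "finite V'" "finite E'" using H finite_V finite_E finite_subset by blast+
  have "real (card V') = 2 / ?m * real (card E')"
    using H(1,5) m fin by (auto simp: field_simps)
  also have "\<dots> \<le> (\<Sum>e\<in>E'. edge_flow E w e)"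
    using sum_mono[of E' "\<lambda>_. 2 / ?m" "edge_flow E w"] flow_ge H(3) by (auto simp: mult.commute)
  finally have covered: "real (card V') \<le> (\<Sum>e\<in>E'. edge_flow E w e)" .
  \<comment> \<open>the part of the weighted degree, as a fraction, that is not spent on \<open>E'\<close>\<close>
  define slack where "slack x = 1 - (\<Sum>e\<in>{e \<in> E'. x \<in> e}. w e) / wdeg E w x" for x
  have slack_nonneg: "0 \<le> slack x" if "x \<in> V'" for x
    using incident_share_le_1[OF w _ H(3), of x] H(2) that by (auto simp: slack_def)
  have "sum slack V' \<le> 0"
    using covered sum_edge_flow[OF H(2-4), of w] by (simp add: slack_def sum_subtractf)
  then have "sum slack V' = 0" using slack_nonneg by (intro antisym sum_nonneg) auto
  then have tight: "slack x = 0" if "x \<in> V'" for x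
    using sum_nonneg_eq_0_iff[OF fin(1) slack_nonneg] that by simp
  have closed: "e \<in> E'" if x: "x \<in> V'" and e: "e \<in> E" "x \<in> e" for x e
  proof (rule ccontr)
    assume "e \<notin> E'"
    then have "(\<Sum>e\<in>{e \<in> E'. x \<in> e}. w e) < (\<Sum>e\<in>{e \<in> E. x \<in> e}. w e)"
      using e H(3) finite_E w
      by (intro sum_strict_mono2[of _ _ e]) (auto simp: pos_weight_def less_imp_le)
    then show False
      using tight[OF x] wdeg_pos[OF w, of x] x H(2) by (auto simp: slack_def wdeg_eq_sum_incident)
  qed
  have side: "(x \<in> V') = (y \<in> V')" if "{x, y} \<in> E" for x y
    using closed[OF _ that] H(4) by blast
  obtain x0 where x0: "x0 \<in> V'" using H(1) by blast
  have V': "V' = V"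
    using constant_on_vertices[of "\<lambda>x. x \<in> V'", OF side, of x0] x0 H(2) by blast
  have E': "E' = E"
  proof
    show "E \<subseteq> E'"
    proof
      fix e assume "e \<in> E"
      then show "e \<in> E'" using edgeE[of e] closed[of _ e] edgeD V' by (metis insertI1)
    qed
  qed (rule H(3))
  have "(\<Sum>e\<in>E. edge_flow E w e - 2 / ?m) = 0"
    using sum_edge_flow_all[OF w] \<open>real (card V') = 2 / ?m * real (card E')\<close>
    by (simp add: sum_subtractf V' E')
  then have flow: "edge_flow E w e = 2 / ?m" if "e \<in> E" for e
    using sum_nonneg_0[OF finite_E, of "\<lambda>e. edge_flow E w e - 2 / ?m" e] flow_ge that by force
  have step: "step_prob E w x y = 1 / ?m" if e: "{x, y} \<in> E" for x y
  proof -
    let ?p = "step_prob E w x y" and ?q = "step_prob E w y x"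
    have e': "{y, x} \<in> E" using e by (simp add: insert_commute)
    have sum: "?p + ?q = 2 / ?m" using flow[OF e] edge_flow_edge[OF e] by simp
    have "4 - real l + (real l - 2) * ((?p + ?q) / 2) \<le> 2 * ?p - (real l - 4) * (1 - ?q)"
      "4 - real l + (real l - 2) * ((?p + ?q) / 2) \<le> 2 * ?q - (real l - 4) * (1 - ?p)"
      using kappa_LLY_graph_le[OF e, of w] kappa_LLY_le_step_prob[OF e w]
        kappa_LLY_graph_le[OF e', of w] kappa_LLY_le_step_prob[OF e' w] eq
      unfolding sum by simp_all
    then have "?p = ?q" using l by auto
    then show ?thesis using sum by simp
  qed
  have wdeg_edge: "wdeg E w x = ?m * w {x, y}" if e: "{x, y} \<in> E" for x y
    using step[OF e] wdeg_pos[OF w, of x] edgeD[OF e] m by (simp add: step_prob_def field_simps)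
  have wdeg_const: "wdeg E w x = wdeg E w x0" if "x \<in> V" for x
  proof (rule constant_on_vertices)
    show "wdeg E w x = wdeg E w y" if "{x, y} \<in> E" for x y
      using wdeg_edge[OF that] wdeg_edge[of y x] that by (simp add: insert_commute)
  qed (use that x0 V' in auto)
  have card: "real (card (nbrs E x)) = ?m" if "x \<in> V" for x
  proof -
    have "(\<Sum>z\<in>nbrs E x. step_prob E w x z) = (\<Sum>z\<in>nbrs E x. 1 / ?m)"
      using step by (intro sum.cong) (auto simp: nbrs_iff)
    then show ?thesis using sum_step_prob[OF w that] m by (simp add: field_simps)
  qed
  show thesis
  proof
    have x0V: "x0 \<in> V" using x0 V' by simp
    show "regular_graph V E (card (nbrs E x0))"
      using card card[OF x0V] by (metis of_nat_eq_iff regular_graph_def)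
    show "step_prob E w x y = 1 / real (card (nbrs E x0))" if "{x, y} \<in> E" for x y
      using step[OF that] card[OF x0V] by simp
    show "w e = wdeg E w x0 / ?m" if e: "e \<in> E" for e
    proof -
      obtain x y where xy: "e = {x, y}" using edgeE[OF e] .
      then show ?thesis
        using wdeg_edge[of x y] wdeg_const[of x] edgeD[of x y] e m by (simp add: field_simps)
    qed
  qed
qed

text \<open>For transition probabilities \<open>1 / d\<close> the test bound with \<open>N\<close> the set of all partners of \<open>S\<close>
  is \<open>4 - l + (l - 2 + |N| - |S|) / d\<close>. A curvature of at least \<open>4 - l + (l - 2) / d\<close> thus is Hall's
  condition for the auxiliary bipartite graph.\<close>

lemma matching_of_kappa_LLY:
  assumes reg: "regular_graph V E d" and e: "{x, y} \<in> E" and w: "pos_weight E w"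
    and step: "\<And>a b. {a, b} \<in> E \<Longrightarrow> step_prob E w a b = 1 / real d"
    and kappa: "4 - real l + (real l - 2) / real d \<le> kappa_LLY V E w x y"
  shows "\<exists>m. bij_betw m (aux_part E x y) (aux_part E y x) \<and>
    (\<forall>u\<in>aux_part E x y. gdist E u (m u) = l - 3)"
proof -
  let ?X = "aux_part E x y" and ?Y = "aux_part E y x"
  define N where "N u = {v \<in> ?Y. gdist E u v = l - 3}" for u
  have e': "{y, x} \<in> E" using e by (simp add: insert_commute)
  have dpos: "0 < real d" using regular_degree_pos[OF reg] by simp
  have hall: "card S \<le> card (\<Union>(N ` S))" if S: "S \<subseteq> ?X" for S
  proof -
    let ?N = "\<Union>(N ` S)"
    have N: "?N \<subseteq> ?Y" by (auto simp: N_def)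
    have "kappa_LLY V E w x y \<le> 1 + step_prob E w x y - (\<Sum>u\<in>S. step_prob E w x u)
        - (real l - 3) * (1 - step_prob E w y x) + (\<Sum>v\<in>?N. step_prob E w y v)"
      by (rule kappa_LLY_le_test[OF e w S N]) (auto simp: N_def)
    also have "(\<Sum>u\<in>S. step_prob E w x u) = (\<Sum>u\<in>S. 1 / real d)"
      using S by (intro sum.cong) (auto simp: aux_part_iff step)
    also have "(\<Sum>v\<in>?N. step_prob E w y v) = (\<Sum>v\<in>?N. 1 / real d)"
      using N by (intro sum.cong) (auto simp: aux_part_iff step)
    finally have "real (card S) / real d \<le> real (card ?N) / real d"
      using kappa unfolding step[OF e] step[OF e']
      by (simp add: right_diff_distrib left_diff_distrib diff_divide_distrib)
    then have "real (card S) \<le> real (card ?N)" using dpos by (simp add: divide_le_cancel)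
    then show ?thesis by simp
  qed
  obtain m where m: "inj_on m ?X" "\<forall>u\<in>?X. m u \<in> N u"
    using hall_marriage[of ?X N] hall by (auto simp: N_def)
  have "card (m ` ?X) = card ?Y"
    using reg e e' edgeD[OF e] card_image[OF m(1)]
    by (simp add: aux_part_def nbrs_iff regular_graph_def)
  moreover have "m ` ?X \<subseteq> ?Y" using m(2) by (auto simp: N_def)
  ultimately have "m ` ?X = ?Y" by (intro card_subset_eq) auto
  then show ?thesis using m by (auto simp: bij_betw_def N_def)
qed

lemma aux_matching_iff:
  assumes "{x, y} \<in> E"
  shows "(\<exists>M. perfect_matching (aux_verts E x y) (aux_edges l E x y) M) \<longleftrightarrow>
    (\<exists>m. bij_betw m (aux_part E x y) (aux_part E y x) \<and>
      (\<forall>u\<in>aux_part E x y. gdist E u (m u) = l - 3))"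
  unfolding aux_verts_def aux_edges_def
  by (rule perfect_matching_bipartite_iff[OF aux_parts_disjoint[OF assms]])

lemma bound_attained_imp:
  assumes w: "pos_weight E w"
    and eq: "kappa_LLY_graph V E w = 4 - real l + (real l - 2) / mad V E"
  shows "\<exists>d. regular_graph V E d"
    and "{x, y} \<in> E \<Longrightarrow> \<exists>M. perfect_matching (aux_verts E x y) (aux_edges l E x y) M"
    and "\<exists>c. \<forall>e\<in>E. w e = c"
proof -
  obtain d c where d: "regular_graph V E d"
    "\<And>x y. {x, y} \<in> E \<Longrightarrow> step_prob E w x y = 1 / real d" and c: "\<And>e. e \<in> E \<Longrightarrow> w e = c"
    by (rule extremal_weight[OF w eq]) blast
  show "\<exists>d. regular_graph V E d" "\<exists>c. \<forall>e\<in>E. w e = c" using d c by blast+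
  show "\<exists>M. perfect_matching (aux_verts E x y) (aux_edges l E x y) M" if e: "{x, y} \<in> E"
    unfolding aux_matching_iff[OF e]
    by (rule matching_of_kappa_LLY[OF d(1) e w d(2)])
      (use kappa_LLY_graph_le[OF e, of w] eq mad_regular[OF d(1)] in auto)
qed

lemma bound_attained_by_unit_weight:
  assumes reg: "regular_graph V E d"
    and pm: "\<And>x y. {x, y} \<in> E \<Longrightarrow> \<exists>M. perfect_matching (aux_verts E x y) (aux_edges l E x y) M"
  shows "kappa_LLY_graph V E (\<lambda>_. 1) = 4 - real l + (real l - 2) / mad V E"
proof (rule antisym)
  show "kappa_LLY_graph V E (\<lambda>_. 1) \<le> 4 - real l + (real l - 2) / mad V E"
    by (rule kappa_LLY_graph_le_mad) (simp add: pos_weight_def)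
  show "4 - real l + (real l - 2) / mad V E \<le> kappa_LLY_graph V E (\<lambda>_. 1)"
    unfolding mad_regular[OF reg]
  proof (rule kappa_LLY_graph_greatest)
    fix x y assume e: "{x, y} \<in> E"
    then obtain m where "bij_betw m (aux_part E x y) (aux_part E y x)"
      "\<And>u. u \<in> aux_part E x y \<Longrightarrow> gdist E u (m u) = l - 3"
      using pm[OF e] aux_matching_iff[OF e] by blast
    then show "4 - real l + (real l - 2) / real d \<le> kappa_LLY V E (\<lambda>_. 1) x y"
      by (rule kappa_LLY_ge_of_matching[OF reg e])
  qed
qed

lemma kappa_LLY_max_le_mad: "kappa_LLY_max V E \<le> 4 - real l + (real l - 2) / mad V E"
  unfolding kappa_LLY_max_def
proof (rule cSUP_least)
  have "pos_weight E (\<lambda>_. 1)" by (simp add: pos_weight_def)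
  then show "{w. pos_weight E w} \<noteq> {}" by blast
qed (use kappa_LLY_graph_le_mad in simp)

lemma kappa_LLY_max_eq:
  assumes "pos_weight E w" "kappa_LLY_graph V E w = 4 - real l + (real l - 2) / mad V E"
  shows "kappa_LLY_max V E = 4 - real l + (real l - 2) / mad V E"
proof (rule antisym[OF kappa_LLY_max_le_mad])
  have "kappa_LLY_graph V E w \<le> kappa_LLY_max V E"
    unfolding kappa_LLY_max_def
    using assms(1) kappa_LLY_graph_le_mad by (intro cSUP_upper bdd_aboveI2) auto
  then show "4 - real l + (real l - 2) / mad V E \<le> kappa_LLY_max V E" using assms(2) by simp
qed

end

theorem theorem5p5:
  fixes V :: "'a set" and E :: "'a set set" and l :: nat
  assumes "l \<in> {4, 5}"
    and "finite_simple_graph V E"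
    and "connected_graph V E"
    and "E \<noteq> {}"
    and "girth E \<ge> enat l"
  shows "kappa_LLY_max V E \<le> 4 - real l + (real l - 2) / mad V E \<and>
    ((\<exists>w. pos_weight E w \<and>
          kappa_LLY_graph V E w = 4 - real l + (real l - 2) / mad V E) \<longleftrightarrow>
     (\<exists>d. regular_graph V E d) \<and>
     (\<forall>x y. {x, y} \<in> E \<longrightarrow> (\<exists>M. perfect_matching (aux_verts E x y) (aux_edges l E x y) M))) \<and>
    (\<forall>d. regular_graph V E d \<and>
         (\<forall>x y. {x, y} \<in> E \<longrightarrow> (\<exists>M. perfect_matching (aux_verts E x y) (aux_edges l E x y) M)) \<longrightarrow>
         kappa_LLY_max V E = 4 - real l + (real l - 2) / real d \<and>
         (\<forall>w. maximizing_weight V E w \<longrightarrow> (\<exists>c. \<forall>e\<in>E. w e = c)))"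
proof -
  interpret girth_graph V E l using assms by unfold_locales
  let ?bound = "4 - real l + (real l - 2) / mad V E"
  let ?PM = "\<forall>x y. {x, y} \<in> E \<longrightarrow> (\<exists>M. perfect_matching (aux_verts E x y) (aux_edges l E x y) M)"
  have one: "pos_weight E (\<lambda>_. 1)" by (simp add: pos_weight_def)
  have unit: "kappa_LLY_graph V E (\<lambda>_. 1) = ?bound" if "regular_graph V E d" ?PM for d
    by (rule bound_attained_by_unit_weight[OF that(1)]) (use that(2) in simp)
  have attained_iff: "(\<exists>w. pos_weight E w \<and> kappa_LLY_graph V E w = ?bound) \<longleftrightarrow>
      (\<exists>d. regular_graph V E d) \<and> ?PM" (is "?L \<longleftrightarrow> ?R")
  proof
    assume ?L
    then obtain w where w: "pos_weight E w" "kappa_LLY_graph V E w = ?bound" by (elim exE conjE)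
    show ?R using bound_attained_imp(1,2)[OF w] by (intro conjI allI impI)
  next
    assume ?R
    then obtain d where "regular_graph V E d" ?PM by (elim exE conjE)
    then show ?L using one unit by (intro exI[of _ "\<lambda>_. 1"] conjI)
  qed
  have extremal: "kappa_LLY_max V E = 4 - real l + (real l - 2) / real d \<and>
      (\<forall>w. maximizing_weight V E w \<longrightarrow> (\<exists>c. \<forall>e\<in>E. w e = c))"
    if dPM: "regular_graph V E d \<and> ?PM" for d
  proof -
    have max: "kappa_LLY_max V E = ?bound"
      using kappa_LLY_max_eq[OF one unit[of d]] dPM by (elim conjE)
    have "\<exists>c. \<forall>e\<in>E. w e = c" if "maximizing_weight V E w" for w
      using that max bound_attained_imp(3)[of w] by (simp only: maximizing_weight_def)
    then show ?thesis using max mad_regular[of d] dPM by simp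
  qed
  show ?thesis
    by (intro conjI[OF kappa_LLY_max_le_mad conjI[OF attained_iff]] allI impI) (rule extremal)
qed

end
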